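(* Let $\mathcal X\subset\mathbb R^m$ be compact, $A\in\mathbb R^{d\times m}$, $b\in\mathbb R^d$, $\alpha>0$, $\beta>0$, and let $g:\mathbb R^d\to\mathbb R$ be convex and differentiable with globally $\frac1\beta$-Lipschitz gradient. Let $\rho,\eta\in\mathcal P(\mathcal X)$, let $x_\rho,x_\eta$ solve the primal MEM problems with priors $\rho,\eta$, and let $z_\rho,z_\eta$ solve the respective dual MEM problems. Then: (i) With $K'=\|A\|\,|\mathrm{supp}(\rho)|_\infty^2$ and $I$ the $m\times m$ identity matrix, $$\|x_\rho-x_\eta\|\le K'\|z_\rho-z_\eta\|+\kappa'(I,\rho,\eta)\left|\int\exp\langle A^\top z_\eta,u\rangle\,d(\eta-\rho)(u)\right|+\zeta'(I,\rho,\eta)\left\|\int u\exp\langle A^\top z_\eta,u\rangle\,d(\rho-\eta)(u)\right\|.$$ (ii) If $A$ is injective and $g$ is $\frac1\gamma$-strongly convex (for some $\gamma>0$), then $$\|x_\rho-x_\eta\|\le\frac{\gamma}{\alpha\,\sigma_{\min}(A)}\|z_\rho-z_\eta\|.$$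
   Context: $\mathcal P(\mathcal X)$ is the set of Borel probability measures on $\mathcal X$. $\|\cdot\|$ is the Euclidean norm on vectors and the operator $2$-norm on matrices; $\sigma_{\min}(A)=\sqrt{\lambda_{\min}(A^\top A)}$; for a set $S$, $|S|_\infty:=\sup_{s\in S}\|s\|$. $g^*$ is the Fenchel conjugate of $g$. For measures, $\int f\,d(\eta-\rho):=\int f\,d\eta-\int f\,d\rho$; vector-valued integrals are componentwise. For $\mu\in\mathcal P(\mathcal X)$, $L_\mu(y):=\log\int_{\mathcal X}\exp\langle y,u\rangle\,d\mu(u)$, and the dual MEM problem with prior $\mu$ is to minimize over $z\in\mathbb R^d$ the function $\phi_\mu(z):=\alpha g^*(-z/\alpha)-\langle b,z\rangle+L_\mu(A^\top z)$, which is $\frac\beta\alpha$-strongly convex and has a unique minimizer $z_\mu$. The primal MEM problem with prior $\mu$ is to minimize $\alpha g(Ax-b)+\kappa_\mu(x)$ over $x\in\mathbb R^m$, where $\kappa_\mu(x):=\inf\{\mathrm{KL}(Q\Vert\mu):Q\in\mathcal P(\mathcal X),\ \mathbb E_Q[X]=x\}$ and $\mathrm{KL}(Q\Vert\mu)=\int\log\frac{dQ}{d\mu}dQ$ if $Q\ll\mu$, $+\infty$ otherwise; it has a unique solution $x_\mu$, and $x_\mu=\nabla L_\mu(A^\top z_\mu)$. For $\mu\in\mathcal P(\mathcal X)$ and $z\in\mathbb R^d$, $\gamma_{\mu,z}\in\mathcal P(\mathcal X)$ is the probability measure with density $\frac{d\gamma_{\mu,z}}{d\mu}(u)=\frac{\exp\langle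 A^\top z,u\rangle}{\int\exp\langle A^\top z,\cdot\rangle d\mu}$. For a matrix $B$, put $$\zeta(B,\eta,z):=\|B\|\Big(\int\exp\langle A^\top z,\cdot\rangle d\eta\Big)^{-1},\qquad \kappa(B,\rho,\eta,z):=\|\mathbb E_{\gamma_{\rho,z}}[X]\|\,\zeta(B,\eta,z),$$ $$\kappa'(B,\rho,\eta):=\max\{\kappa(B,\rho,\eta,z_\eta),\kappa(B,\eta,\rho,z_\eta)\},\qquad \zeta'(B,\rho,\eta):=\max\{\zeta(B,\rho,z_\eta),\zeta(B,\eta,z_\eta)\}.$$ *)

theory Defs
  imports "HOL-Probability.Probability"
begin

definition borel_probs :: "(real ^ 'm) set \<Rightarrow> (real ^ 'm) measure set" where
  "borel_probs X = {Q. prob_space Q \<and> sets Q = sets (restrict_space borel X)}"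

definition supp :: "('a :: topological_space) measure \<Rightarrow> 'a set" where
  "supp \<mu> = {x \<in> space \<mu>. \<forall>U. open U \<and> x \<in> U \<longrightarrow> emeasure \<mu> (U \<inter> space \<mu>) > 0}"

definition set_sup_norm :: "('a :: real_normed_vector) set \<Rightarrow> real" where
  "set_sup_norm S = (SUP s\<in>S. norm s)"

text \<open>The instance \<open>norm\<close> on matrices is the Frobenius norm, so the operator 2-norm is
  expressed through \<^const>\<open>onorm\<close>.\<close>

definition op_norm :: "real ^ 'm ^ 'n \<Rightarrow> real" where
  "op_norm B = onorm (\<lambda>x. B *v x)"

text \<open>The smallest eigenvalue; used only for symmetric matrices, whose eigenvalues are all real.\<close>

definition lambda_min :: "real ^ 'm ^ 'm \<Rightarrow> real" where
  "lambda_min B = (LEAST l. \<exists>v. v \<noteq> 0 \<and> B *v v = l *\<^sub>R v)"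

definition sigma_min :: "real ^ 'm ^ 'd \<Rightarrow> real" where
  "sigma_min A = sqrt (lambda_min (transpose A ** A))"

definition fenchel_conjugate :: "(('a :: real_inner) \<Rightarrow> real) \<Rightarrow> 'a \<Rightarrow> ereal" where
  "fenchel_conjugate g y = (SUP x. ereal (y \<bullet> x - g x))"

definition strongly_convex :: "real \<Rightarrow> (('a :: real_normed_vector) \<Rightarrow> real) \<Rightarrow> bool" where
  "strongly_convex c f \<longleftrightarrow>
    (\<forall>x y. \<forall>t\<in>{0..1}.
      f ((1 - t) *\<^sub>R x + t *\<^sub>R y) \<le>
        (1 - t) * f x + t * f y - c / 2 * t * (1 - t) * (norm (x - y))\<^sup>2)"

text \<open>The integral of \<open>log (dQ/d\<mu>)\<close> is taken in the extended sense, as the difference of the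
  integrals of its positive and negative parts (\<^const>\<open>ennreal\<close> truncates negative numbers to 0),
  because it can be infinite even for \<open>Q\<close> absolutely continuous with respect to \<open>\<mu>\<close>. The Bochner
  integral, and with it the library's \<open>KL_divergence\<close>, would return 0 in that case.
  The integral of the negative part is always finite.\<close>

definition KL :: "'a measure \<Rightarrow> 'a measure \<Rightarrow> ereal" where
  "KL Q \<mu> =
    (if absolutely_continuous \<mu> Q then
       enn2ereal (\<integral>\<^sup>+u. ennreal (ln (enn2real (RN_deriv \<mu> Q u))) \<partial>Q)
       - enn2ereal (\<integral>\<^sup>+u. ennreal (- ln (enn2real (RN_deriv \<mu> Q u))) \<partial>Q)
     else \<infinity>)"

text \<open>The infimum over the empty set is \<open>\<infinity>\<close>.\<close>

definition kappa_prior :: "(real ^ 'm) set \<Rightarrow> (real ^ 'm) measure \<Rightarrow> real ^ 'm \<Rightarrow> ereal" where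
  "kappa_prior X \<mu> x = (INF Q \<in> {Q \<in> borel_probs X. (\<integral>u. u \<partial>Q) = x}. KL Q \<mu>)"

definition primal_objective ::
  "(real ^ 'm) set \<Rightarrow> real ^ 'm ^ 'd \<Rightarrow> real ^ 'd \<Rightarrow> real \<Rightarrow> (real ^ 'd \<Rightarrow> real) \<Rightarrow>
     (real ^ 'm) measure \<Rightarrow> real ^ 'm \<Rightarrow> ereal" where
  "primal_objective X A b \<alpha> g \<mu> x = ereal (\<alpha> * g (A *v x - b)) + kappa_prior X \<mu> x"

definition log_mgf :: "(real ^ 'm) measure \<Rightarrow> real ^ 'm \<Rightarrow> real" where
  "log_mgf \<mu> y = ln (\<integral>u. exp (y \<bullet> u) \<partial>\<mu>)"

definition dual_objective ::
  "real ^ 'm ^ 'd \<Rightarrow> real ^ 'd \<Rightarrow> real \<Rightarrow> (real ^ 'd \<Rightarrow> real) \<Rightarrow>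
     (real ^ 'm) measure \<Rightarrow> real ^ 'd \<Rightarrow> ereal" where
  "dual_objective A b \<alpha> g \<mu> z =
    ereal \<alpha> * fenchel_conjugate g (- z /\<^sub>R \<alpha>) - ereal (b \<bullet> z)
      + ereal (log_mgf \<mu> (transpose A *v z))"

definition solves_primal ::
  "(real ^ 'm) set \<Rightarrow> real ^ 'm ^ 'd \<Rightarrow> real ^ 'd \<Rightarrow> real \<Rightarrow> (real ^ 'd \<Rightarrow> real) \<Rightarrow>
     (real ^ 'm) measure \<Rightarrow> real ^ 'm \<Rightarrow> bool" where
  "solves_primal X A b \<alpha> g \<mu> x \<longleftrightarrow> is_arg_min (primal_objective X A b \<alpha> g \<mu>) (\<lambda>_. True) x"

definition solves_dual ::
  "real ^ 'm ^ 'd \<Rightarrow> real ^ 'd \<Rightarrow> real \<Rightarrow> (real ^ 'd \<Rightarrow> real) \<Rightarrow>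
     (real ^ 'm) measure \<Rightarrow> real ^ 'd \<Rightarrow> bool" where
  "solves_dual A b \<alpha> g \<mu> z \<longleftrightarrow> is_arg_min (dual_objective A b \<alpha> g \<mu>) (\<lambda>_. True) z"

definition partition_fun :: "real ^ 'm ^ 'd \<Rightarrow> (real ^ 'm) measure \<Rightarrow> real ^ 'd \<Rightarrow> real" where
  "partition_fun A \<mu> z = (\<integral>u. exp ((transpose A *v z) \<bullet> u) \<partial>\<mu>)"

definition gibbs :: "real ^ 'm ^ 'd \<Rightarrow> (real ^ 'm) measure \<Rightarrow> real ^ 'd \<Rightarrow> (real ^ 'm) measure" where
  "gibbs A \<mu> z =
    density \<mu> (\<lambda>u. ennreal (exp ((transpose A *v z) \<bullet> u) / partition_fun A \<mu> z))"

definition zeta ::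
  "real ^ 'm ^ 'd \<Rightarrow> real ^ 'm ^ 'n \<Rightarrow> (real ^ 'm) measure \<Rightarrow> real ^ 'd \<Rightarrow> real" where
  "zeta A B \<eta> z = op_norm B * inverse (partition_fun A \<eta> z)"

definition kappa ::
  "real ^ 'm ^ 'd \<Rightarrow> real ^ 'm ^ 'n \<Rightarrow> (real ^ 'm) measure \<Rightarrow> (real ^ 'm) measure \<Rightarrow>
     real ^ 'd \<Rightarrow> real" where
  "kappa A B \<rho> \<eta> z = norm (\<integral>u. u \<partial>gibbs A \<rho> z) * zeta A B \<eta> z"

text \<open>In the next two definitions the last argument stands for the dual solution \<open>z\<^sub>\<eta>\<close>.\<close>

definition kappa' ::
  "real ^ 'm ^ 'd \<Rightarrow> real ^ 'm ^ 'n \<Rightarrow> (real ^ 'm) measure \<Rightarrow> (real ^ 'm) measure \<Rightarrow>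
     real ^ 'd \<Rightarrow> real" where
  "kappa' A B \<rho> \<eta> z\<eta> = max (kappa A B \<rho> \<eta> z\<eta>) (kappa A B \<eta> \<rho> z\<eta>)"

definition zeta' ::
  "real ^ 'm ^ 'd \<Rightarrow> real ^ 'm ^ 'n \<Rightarrow> (real ^ 'm) measure \<Rightarrow> (real ^ 'm) measure \<Rightarrow>
     real ^ 'd \<Rightarrow> real" where
  "zeta' A B \<rho> \<eta> z\<eta> = max (zeta A B \<rho> z\<eta>) (zeta A B \<eta> z\<eta>)"

end

theory Submission imports Defs begin

text \<open>
  Write \<open>L = log_mgf \<mu>\<close> and let \<open>tilted_mean \<mu> y\<close> be the mean of the Gibbs measure with exponent
  \<open>\<langle>y, u\<rangle>\<close>, which is the gradient of \<open>L\<close> at \<open>y\<close>.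
  Passing from \<open>\<mu>\<close> to its tilt turns statements about \<open>L\<close> at \<open>y\<close> into statements at \<open>0\<close>, where
  Jensen's inequality and Hoeffding's lemma give
  \<open>\<langle>w, m(y)\<rangle> \<le> L(y + w) - L(y) \<le> \<langle>w, m(y)\<rangle> + R\<^sup>2/2 \<parallel>w\<parallel>\<^sup>2\<close>,
  with \<open>m(y)\<close> the tilted mean and \<open>R\<close> the largest norm on the support of \<open>\<mu>\<close>
  (\<open>log_mgf_ge_linear\<close>, \<open>log_mgf_le_quadratic\<close>). These two bounds carry the whole proof.

  \<^item> They imply that \<open>m\<close> is Lipschitz with constant \<open>R\<^sup>2\<close>, by the Baillon--Haddad
    argument (\<open>lipschitz_gradient_of_quadratic_bounds\<close>).
  \<^item> They give the first-order condition of the dual problem: at a dual solution \<open>z\<close>, the vector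
    \<open>-z/\<alpha>\<close> is a subgradient of \<open>g\<close> at \<open>A m - b\<close>, where \<open>m = m(A\<^sup>T z)\<close>
    (\<open>solves_dual_imp_subgradient\<close>).
  \<^item> By the Donsker--Varadhan inequality \<open>KL Q \<mu> \<ge> \<langle>y, E\<^sub>Q X\<rangle> - L(y)\<close>, an equality when \<open>Q\<close> is the
    tilt (\<open>KL_ge\<close>, \<open>KL_tilt\<close>), the point \<open>m\<close> then minimises the primal objective, and moving \<open>y\<close>
    slightly in the direction \<open>x - m\<close> shows that it is the only minimiser
    (\<open>solves_primal_imp_tilted_mean\<close>).

  So both primal solutions are tilted means. For the first estimate, change the exponent with the
  prior \<open>\<rho>\<close> kept, which costs the Lipschitz constant, and then change the prior at the exponent
  \<open>A\<^sup>T z\<^sub>\<eta>\<close>, which is a comparison of two quotients of integrals (\<open>tilted_mean_prior_change\<close>). For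
  the second estimate, strong convexity of \<open>g\<close> makes its subgradients strongly monotone, so the distance
  of \<open>A x\<^sub>\<rho>\<close> and \<open>A x\<^sub>\<eta>\<close> is controlled by that of the subgradients \<open>-z\<^sub>\<rho>/\<alpha>\<close> and \<open>-z\<^sub>\<eta>/\<alpha>\<close>, and
  \<open>\<parallel>A x\<parallel> \<ge> \<sigma>\<^sub>m\<^sub>i\<^sub>n(A) \<parallel>x\<parallel>\<close>.
\<close>

section \<open>Convex functions and their gradients\<close>

text \<open>
  The shape in which every first-order optimality condition below is extracted: compare a minimiser
  with nearby points on a segment, bound the second-order term, and let \<open>t\<close> tend to 0.
\<close>
lemma first_order_nonneg:
  fixes a C :: real
  assumes "\<And>t. 0 < t \<Longrightarrow> t \<le> 1 \<Longrightarrow> 0 \<le> t * a + t\<^sup>2 * C"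
  shows "0 \<le> a"
proof (rule ccontr)
  assume "\<not> 0 \<le> a"
  then have a: "a < 0" by simp
  \<comment> \<open>So small that the quadratic term consumes at most half of \<open>\<bar>a\<bar>\<close>.\<close>
  define t where "t = min 1 (- a / (2 * (\<bar>C\<bar> + 1)))"
  have t: "0 < t" "t \<le> 1"
    using a divide_neg_pos[of a "2 * (\<bar>C\<bar> + 1)"] by (auto simp: t_def)
  have "t \<le> (- a / 2) / (\<bar>C\<bar> + 1)"
    by (simp add: t_def divide_divide_eq_left)
  then have t': "t * (\<bar>C\<bar> + 1) \<le> - a / 2"
    by (subst (asm) pos_le_divide_eq) auto
  have "t * C \<le> t * (\<bar>C\<bar> + 1)"
    using t(1) by (intro mult_left_mono) auto
  with t' a have "a + t * C < 0" by linarith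
  with t(1) have "t * (a + t * C) < 0" by (simp add: mult_pos_neg)
  with assms[OF t(1,2)] show False by (simp add: algebra_simps power2_eq_square)
qed

text \<open>
  Restriction to the line through \<open>x\<close> and \<open>y\<close> reduces this to a convex function of one real variable.
\<close>
lemma convex_gradient_inequality:
  fixes g :: "'a::real_inner \<Rightarrow> real"
  assumes "convex_on UNIV g" and "GDERIV g x :> D"
  shows "g y \<ge> g x + D \<bullet> (y - x)"
proof -
  define h where "h = (\<lambda>t. g (x + t *\<^sub>R (y - x)))"
  have "convex_on UNIV h"
  proof (rule convex_onI)
    fix t u v :: real assume t: "0 < t" "t < 1"
    have "x + ((1 - t) * u + t * v) *\<^sub>R (y - x)
        = (1 - t) *\<^sub>R (x + u *\<^sub>R (y - x)) + t *\<^sub>R (x + v *\<^sub>R (y - x))"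
      by (simp add: algebra_simps)
    then show "h ((1 - t) *\<^sub>R u + t *\<^sub>R v) \<le> (1 - t) * h u + t * h v"
      using convex_onD[OF assms(1), of t "x + u *\<^sub>R (y - x)" "x + v *\<^sub>R (y - x)"] t
      by (simp add: h_def)
  qed simp
  moreover have "(h has_field_derivative (y - x) \<bullet> D) (at 0)"
  proof -
    have g: "(g has_derivative (\<lambda>k. k \<bullet> D)) (at (x + 0 *\<^sub>R (y - x)))"
      using assms(2) by (simp add: gderiv_def)
    have "(h has_derivative (\<lambda>t. (t *\<^sub>R (y - x)) \<bullet> D)) (at 0)"
      unfolding h_def
      by (rule has_derivative_compose[where g = g and f = "\<lambda>t. x + t *\<^sub>R (y - x)", OF _ g]) (auto intro!: derivative_eq_intros)
    then show ?thesis
      by (simp add: has_field_derivative_def mult.commute[of _ "(y - x) \<bullet> D"])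
  qed
  ultimately have "h 1 - h 0 \<ge> (y - x) \<bullet> D * (1 - 0)"
    by (intro convex_on_imp_above_tangent[where A = UNIV]) auto
  then show ?thesis by (simp add: h_def inner_commute)
qed

text \<open>
  Apply both hypotheses at \<open>(1 - t) x + t y\<close>, divide by \<open>t\<close> and let \<open>t\<close> tend to 0.
\<close>
lemma strongly_convex_subgradient:
  fixes f :: "'a::real_inner \<Rightarrow> real"
  assumes "strongly_convex c f" and sub: "\<And>v. f v \<ge> f x + p \<bullet> (v - x)"
  shows "f y \<ge> f x + p \<bullet> (y - x) + c / 2 * (norm (y - x))\<^sup>2"
proof -
  let ?q = "c / 2 * (norm (y - x))\<^sup>2"
  have "0 \<le> t * (f y - f x - p \<bullet> (y - x) - ?q) + t\<^sup>2 * ?q" if t: "0 < t" "t \<le> 1" for t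
  proof -
    have "(1 - t) *\<^sub>R x + t *\<^sub>R y - x = t *\<^sub>R (y - x)" by (simp add: algebra_simps)
    then have "f x + t * (p \<bullet> (y - x)) \<le> f ((1 - t) *\<^sub>R x + t *\<^sub>R y)"
      using sub[of "(1 - t) *\<^sub>R x + t *\<^sub>R y"] by simp
    also have "\<dots> \<le> (1 - t) * f x + t * f y - c / 2 * t * (1 - t) * (norm (x - y))\<^sup>2"
      using assms(1) t unfolding strongly_convex_def by auto
    finally show ?thesis
      by (simp add: field_simps power2_eq_square norm_minus_commute)
  qed
  from first_order_nonneg[OF this] show ?thesis by simp
qed

text \<open>
  Adding the quadratic lower bounds at the two points leaves \<open>c \<parallel>x - y\<parallel>\<^sup>2 \<le> \<langle>p - q, x - y\<rangle>\<close>.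
\<close>
lemma strongly_convex_subgradient_monotone:
  fixes f :: "'a::real_inner \<Rightarrow> real"
  assumes "strongly_convex c f"
    and px: "\<And>v. f v \<ge> f x + p \<bullet> (v - x)" and qy: "\<And>v. f v \<ge> f y + q \<bullet> (v - y)"
  shows "c * norm (x - y) \<le> norm (p - q)"
proof -
  have "c * (norm (x - y))\<^sup>2 \<le> (p - q) \<bullet> (x - y)"
    using strongly_convex_subgradient[OF assms(1) px, of y]
      strongly_convex_subgradient[OF assms(1) qy, of x]
    by (simp add: inner_diff_left inner_diff_right norm_minus_commute)
  also have "\<dots> \<le> norm (p - q) * norm (x - y)"
    by (rule norm_cauchy_schwarz)
  finally have "(c * norm (x - y)) * norm (x - y) \<le> norm (p - q) * norm (x - y)"
    by (simp add: power2_eq_square algebra_simps)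
  then show ?thesis
    by (cases "x = y") (auto dest: mult_right_le_imp_le)
qed

text \<open>
  The Baillon--Haddad argument. The lower bound says that \<open>L\<close> is convex with gradient \<open>m\<close>, the upper
  bound is the descent inequality. A gradient step from \<open>v\<close> for the function \<open>L - \<langle>m u, \<cdot>\<rangle>\<close>, which is
  minimal at \<open>u\<close>, gains \<open>\<parallel>m v - m u\<parallel>\<^sup>2 / (2 K)\<close>; adding this to the same inequality with \<open>u\<close> and \<open>v\<close> exchanged
  gives cocoercivity of \<open>m\<close>, and Cauchy--Schwarz finishes.
\<close>
lemma lipschitz_gradient_of_quadratic_bounds:
  fixes L :: "'a::real_inner \<Rightarrow> real" and m :: "'a \<Rightarrow> 'a"
  assumes "K \<ge> 0"
    and lower: "\<And>y w. L y + w \<bullet> m y \<le> L (y + w)"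
    and upper: "\<And>y w. L (y + w) \<le> L y + w \<bullet> m y + K / 2 * (norm w)\<^sup>2"
  shows "norm (m x - m y) \<le> K * norm (x - y)"
proof -
  \<comment> \<open>The step length is \<open>1 / K\<close>; a constant \<open>M > K\<close> in place of \<open>K\<close> covers the case \<open>K = 0\<close>.\<close>
  have "norm (m x - m y) \<le> M * norm (x - y)" if "M > K" for M
  proof -
    have M: "M > 0" using that \<open>K \<ge> 0\<close> by simp
    have coercive: "L u + (v - u) \<bullet> m u + (norm (m v - m u))\<^sup>2 / (2 * M) \<le> L v" for u v
    proof -
      define d where "d = m v - m u"
      define w where "w = (- (1 / M)) *\<^sub>R d"
      have "L u + (v + w - u) \<bullet> m u \<le> L (v + w)"
        using lower[of u "v + w - u"] by (simp add: algebra_simps)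
      also have "\<dots> \<le> L v + w \<bullet> m v + K / 2 * (norm w)\<^sup>2"
        by (rule upper)
      also have "\<dots> \<le> L v + w \<bullet> m v + M / 2 * (norm w)\<^sup>2"
        using that by (intro add_left_mono mult_right_mono) auto
      finally have "L u + (v - u) \<bullet> m u \<le> L v + w \<bullet> d + M / 2 * (norm w)\<^sup>2"
        by (simp add: d_def inner_diff_right inner_diff_left inner_add_left)
      then have "L u + (v - u) \<bullet> m u \<le> L v + (w \<bullet> d + M / 2 * (norm w)\<^sup>2)"
        by simp
      also have "w \<bullet> d + M / 2 * (norm w)\<^sup>2 = - (norm d)\<^sup>2 / (2 * M)"
        using M by (simp add: w_def power_mult_distrib power2_norm_eq_inner field_simps power2_eq_square
            flip: power2_norm_eq_inner)
      finally show ?thesis by (simp add: d_def)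
    qed
    have "2 * ((norm (m x - m y))\<^sup>2 / (2 * M)) \<le> (x - y) \<bullet> (m x - m y)"
      using coercive[of x y] coercive[of y x]
      by (simp add: inner_diff_left inner_diff_right norm_minus_commute)
    also have "\<dots> \<le> norm (x - y) * norm (m x - m y)"
      by (rule norm_cauchy_schwarz)
    finally have "norm (m x - m y) * norm (m x - m y) \<le> (M * norm (x - y)) * norm (m x - m y)"
      using M by (simp add: field_simps power2_eq_square)
    then show ?thesis
      using M by (cases "m x = m y") (auto dest: mult_right_le_imp_le)
  qed
  then have *: "norm (m x - m y) \<le> K * norm (x - y) + e * norm (x - y)" if "e > 0" for e
    using that by (metis distrib_right less_add_same_cancel1)
  show ?thesis
  proof (cases "x = y")
    case False
    have "norm (m x - m y) \<le> K * norm (x - y) + e" if "e > 0" for e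
      using *[of "e / norm (x - y)"] False that by simp
    then show ?thesis by (rule field_le_epsilon)
  qed simp
qed

section \<open>Operator norm and smallest singular value\<close>

lemma norm_matrix_vector_le: "norm (B *v x) \<le> op_norm B * norm x"
  unfolding op_norm_def by (rule onorm) (rule matrix_vector_mul_bounded_linear)

lemma op_norm_nonneg: "0 \<le> op_norm B"
  unfolding op_norm_def by (rule onorm_pos_le) (rule matrix_vector_mul_bounded_linear)

lemma op_norm_mat_1: "op_norm (mat 1 :: real ^ 'm ^ 'm) = 1"
proof -
  have "onorm (\<lambda>x :: real ^ 'm. x) = 1"
  proof (rule antisym)
    show "onorm (\<lambda>x :: real ^ 'm. x) \<le> 1" by (rule onorm_id_le)
    have "norm (axis undefined 1 :: real ^ 'm) \<le> onorm (\<lambda>x :: real ^ 'm. x) * norm (axis undefined 1 :: real ^ 'm)"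
      by (rule onorm) (rule bounded_linear_ident)
    then show "1 \<le> onorm (\<lambda>x :: real ^ 'm. x)" by simp
  qed
  then show ?thesis by (simp add: op_norm_def)
qed

text \<open>
  The operator norm of the transpose is bounded through \<open>\<parallel>B\<^sup>T z\<parallel>\<^sup>2 = \<langle>z, B B\<^sup>T z\<rangle>\<close>.
\<close>
lemma norm_transpose_vector_le: "norm (transpose B *v z) \<le> op_norm B * norm z"
proof -
  let ?w = "transpose B *v z"
  have "norm ?w * norm ?w = z \<bullet> (B *v ?w)"
    by (metis dot_lmul_matrix norm_eq_square power2_eq_square power2_norm_eq_inner transpose_matrix_vector)
  also have "\<dots> \<le> norm z * norm (B *v ?w)"
    by (rule norm_cauchy_schwarz)
  also have "\<dots> \<le> norm z * (op_norm B * norm ?w)"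
    by (intro mult_left_mono norm_matrix_vector_le) simp
  finally have "norm ?w * norm ?w \<le> (op_norm B * norm z) * norm ?w"
    by (simp add: algebra_simps)
  then show ?thesis
    using op_norm_nonneg[of B] by (cases "?w = 0") (auto dest: mult_right_le_imp_le)
qed

lemma inner_transpose_mul_self: "((transpose A ** A) *v v) \<bullet> h = (A *v v) \<bullet> (A *v h)"
  for A :: "real ^ 'm ^ 'd"
  by (metis dot_lmul_matrix inner_commute matrix_vector_mul_assoc transpose_matrix_vector)

text \<open>
  The square of \<open>\<parallel>A x\<parallel>\<close> attains a minimum on the unit sphere. The minimiser \<open>v\<close> is an eigenvector of
  \<open>A\<^sup>T A\<close> by the first-order condition, and any eigenvector, being a competitor, has an eigenvalue at least
  as large. In particular the least eigenvalue exists, so that \<open>lambda_min\<close>, a \<open>LEAST\<close>, is the value of the minimum.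
\<close>
lemma lambda_min_gram:
  fixes A :: "real ^ 'm ^ 'd"
  obtains v where "norm v = 1" "lambda_min (transpose A ** A) = (norm (A *v v))\<^sup>2"
    "\<And>x. lambda_min (transpose A ** A) * (norm x)\<^sup>2 \<le> (norm (A *v x))\<^sup>2"
proof -
  let ?G = "transpose A ** A"
  have "compact (sphere (0 :: real ^ 'm) 1)" by simp
  moreover have "sphere (0 :: real ^ 'm) 1 \<noteq> {}" by simp
  moreover have "continuous_on (sphere 0 1) (\<lambda>x. (norm (A *v x))\<^sup>2)"
    by (intro continuous_intros bounded_linear.continuous_on[OF matrix_vector_mul_bounded_linear])
  ultimately obtain v where v: "v \<in> sphere 0 1"
    and min: "\<And>x. x \<in> sphere 0 1 \<Longrightarrow> (norm (A *v v))\<^sup>2 \<le> (norm (A *v x))\<^sup>2"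
    using continuous_attains_inf[of "sphere 0 1" "\<lambda>x. (norm (A *v x))\<^sup>2"] by metis
  define l where "l = (norm (A *v v))\<^sup>2"
  have nv: "norm v = 1" using v by simp
  have bound: "l * (norm x)\<^sup>2 \<le> (norm (A *v x))\<^sup>2" for x
  proof (cases "x = 0")
    case False
    have "l \<le> (norm (A *v (x /\<^sub>R norm x)))\<^sup>2"
      unfolding l_def using False by (intro min) simp
    also have "\<dots> = (norm (A *v x))\<^sup>2 / (norm x)\<^sup>2"
      by (simp add: matrix_vector_mult_scaleR power_mult_distrib divide_inverse power_inverse)
    finally show ?thesis using False by (simp add: field_simps)
  qed simp
  have eigen: "?G *v v = l *\<^sub>R v"
  proof -
    \<comment> \<open>Test the minimality of \<open>v\<close> in the direction of minus the residual \<open>r\<close> of the eigenvalue equation.\<close>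
    define r where "r = ?G *v v - l *\<^sub>R v"
    have "0 \<le> t * (- 2 * (r \<bullet> r)) + t\<^sup>2 * ((norm (A *v r))\<^sup>2 - l * (norm r)\<^sup>2)" for t
    proof -
      have "l * (norm (v - t *\<^sub>R r))\<^sup>2 \<le> (norm (A *v (v - t *\<^sub>R r)))\<^sup>2"
        by (rule bound)
      moreover have "(norm (v - t *\<^sub>R r))\<^sup>2 = 1 - 2 * t * (v \<bullet> r) + t\<^sup>2 * (norm r)\<^sup>2"
        using nv norm_eq_1[of v]
        unfolding power2_norm_eq_inner
        by (simp add: inner_diff_left inner_diff_right inner_commute power2_eq_square algebra_simps)
      moreover have "(norm (A *v (v - t *\<^sub>R r)))\<^sup>2
          = l - 2 * t * ((?G *v v) \<bullet> r) + t\<^sup>2 * (norm (A *v r))\<^sup>2"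
        unfolding inner_transpose_mul_self l_def power2_norm_eq_inner matrix_vector_mult_diff_distrib
          matrix_vector_mult_scaleR
        by (simp add: inner_diff_left inner_diff_right inner_commute power2_eq_square algebra_simps)
      moreover have "(?G *v v) \<bullet> r = r \<bullet> r + l * (v \<bullet> r)"
        by (simp add: r_def inner_diff_left)
      ultimately show ?thesis by (simp add: algebra_simps)
    qed
    then have "0 \<le> - 2 * (r \<bullet> r)" by (rule first_order_nonneg)
    then have "r \<bullet> r = 0" using inner_ge_zero[of r] by linarith
    then show ?thesis by (simp add: r_def)
  qed
  have "lambda_min ?G = l"
    unfolding lambda_min_def
  proof (rule Least_equality)
    show "\<exists>v. v \<noteq> 0 \<and> ?G *v v = l *\<^sub>R v" using eigen nv by (intro exI[of _ v]) auto
  next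
    fix k assume "\<exists>v. v \<noteq> 0 \<and> ?G *v v = k *\<^sub>R v"
    then obtain u where u: "u \<noteq> 0" "?G *v u = k *\<^sub>R u" by blast
    have "(norm (A *v u))\<^sup>2 = k * (norm u)\<^sup>2"
      using inner_transpose_mul_self[of A u u] u(2) by (simp add: power2_norm_eq_inner)
    with bound[of u] have "l * (norm u)\<^sup>2 \<le> k * (norm u)\<^sup>2" by simp
    with u(1) show "l \<le> k" by simp
  qed
  with nv bound show thesis by (intro that[of v]) (auto simp: l_def)
qed

lemma sigma_min_le: "sigma_min A * norm x \<le> norm (A *v x)"
  for A :: "real ^ 'm ^ 'd"
proof -
  obtain v where v: "lambda_min (transpose A ** A) = (norm (A *v v))\<^sup>2"
    "\<And>x. lambda_min (transpose A ** A) * (norm x)\<^sup>2 \<le> (norm (A *v x))\<^sup>2"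
    by (rule lambda_min_gram[of A]) blast
  have "(sigma_min A * norm x)\<^sup>2 \<le> (norm (A *v x))\<^sup>2"
    using v(2)[of x] by (simp add: sigma_min_def v(1) power_mult_distrib)
  then show ?thesis by (rule power2_le_imp_le) simp
qed

lemma sigma_min_pos:
  fixes A :: "real ^ 'm ^ 'd"
  assumes "inj (\<lambda>x. A *v x)"
  shows "0 < sigma_min A"
proof -
  obtain v where v: "norm v = 1" "lambda_min (transpose A ** A) = (norm (A *v v))\<^sup>2"
    by (rule lambda_min_gram[of A])
  have "A *v v \<noteq> A *v 0" using v(1) injD[OF assms, of v 0] by force
  then show ?thesis by (simp add: sigma_min_def v(2))
qed

section \<open>Exponential tilting and the log moment generating function\<close>

definition tilt :: "(real ^ 'm) measure \<Rightarrow> real ^ 'm \<Rightarrow> (real ^ 'm) measure" where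
  "tilt \<mu> y = density \<mu> (\<lambda>u. ennreal (exp (y \<bullet> u) / (\<integral>v. exp (y \<bullet> v) \<partial>\<mu>)))"

abbreviation tilted_mean :: "(real ^ 'm) measure \<Rightarrow> real ^ 'm \<Rightarrow> real ^ 'm" where
  "tilted_mean \<mu> y \<equiv> (\<integral>u. u \<partial>tilt \<mu> y)"

lemma gibbs_eq_tilt: "gibbs A \<mu> z = tilt \<mu> (transpose A *v z)"
  by (simp add: gibbs_def tilt_def partition_fun_def)

text \<open>
  The probability measures on a compact \<open>X\<close>, as a locale, because its lemmas are used not only for the priors
  but also for their tilts and for the competitors \<open>Q\<close> in the primal problem.
\<close>
locale compact_prior = prob_space \<mu> for \<mu> :: "(real ^ 'm) measure" +
  fixes X :: "(real ^ 'm) set"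
  assumes compact_X: "compact X"
    and sets_prior: "sets \<mu> = sets (restrict_space borel X)"

lemma compact_prior_iff: "compact X \<Longrightarrow> compact_prior \<mu> X \<longleftrightarrow> \<mu> \<in> borel_probs X"
  by (auto simp: compact_prior_def compact_prior_axioms_def borel_probs_def)

context compact_prior
begin

lemma space_prior: "space \<mu> = X"
  using sets_eq_imp_space_eq[OF sets_prior] by (simp add: space_restrict_space)

lemma measurable_prior:
  "f \<in> borel_measurable borel \<Longrightarrow> f \<in> borel_measurable \<mu>"
  by (subst measurable_cong_sets[OF sets_prior refl]) (rule measurable_restrict_space1)

lemma AE_in_X: "AE u in \<mu>. u \<in> X"
  using AE_space[of \<mu>] by (simp add: space_prior)

lemma integrable_continuous:
  fixes f :: "real ^ 'm \<Rightarrow> 'b::{banach, second_countable_topology}"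
  assumes "continuous_on UNIV f"
  shows "integrable \<mu> f"
proof -
  have "compact (f ` X)"
    using assms compact_X by (intro compact_continuous_image) (auto intro: continuous_on_subset)
  then obtain B where "\<And>u. u \<in> X \<Longrightarrow> norm (f u) \<le> B"
    using compact_imp_bounded bounded_iff by (metis imageI)
  then have "AE u in \<mu>. norm (f u) \<le> B"
    using AE_in_X by (rule eventually_mono[rotated])
  then show ?thesis
    using assms by (intro integrable_const_bound measurable_prior borel_measurable_continuous_onI)
qed

lemma integrable_ident: "integrable \<mu> (\<lambda>u. u)"
  by (intro integrable_continuous continuous_intros)

lemma integrable_inner: "integrable \<mu> (\<lambda>u. y \<bullet> u)"
  by (intro integrable_continuous continuous_intros)

lemma integrable_exp: "integrable \<mu> (\<lambda>u. exp (y \<bullet> u))"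
  by (intro integrable_continuous continuous_intros)

lemma integral_inner: "(\<integral>u. y \<bullet> u \<partial>\<mu>) = y \<bullet> (\<integral>u. u \<partial>\<mu>)"
  using integrable_ident by simp

text \<open>
  The complement of the support is a union of open null sets; by second countability
  countably many of them suffice.
\<close>
lemma AE_in_supp: "AE u in \<mu>. u \<in> supp \<mu>"
proof -
  define N where "N = {U. open U \<and> emeasure \<mu> (U \<inter> space \<mu>) = 0}"
  obtain N' where N': "N' \<subseteq> N" "countable N'" "\<Union>N' = \<Union>N"
    by (rule Lindelof[of N]) (auto simp: N_def)
  have "(\<Union>U\<in>N'. U \<inter> space \<mu>) \<in> null_sets \<mu>"
  proof (rule null_sets_UN')
    fix U assume "U \<in> N'"
    then have U: "open U" "emeasure \<mu> (U \<inter> space \<mu>) = 0" using N'(1) by (auto simp: N_def)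
    have "U \<inter> space \<mu> \<in> sets \<mu>"
      using U(1) by (auto simp: sets_prior sets_restrict_space space_prior)
    with U(2) show "U \<inter> space \<mu> \<in> null_sets \<mu>" by auto
  qed (fact N'(2))
  moreover have "space \<mu> - supp \<mu> \<subseteq> (\<Union>U\<in>N'. U \<inter> space \<mu>)"
  proof
    fix u assume "u \<in> space \<mu> - supp \<mu>"
    then have "u \<in> space \<mu>" "u \<in> \<Union>N"
      by (auto simp: supp_def N_def)
    then show "u \<in> (\<Union>U\<in>N'. U \<inter> space \<mu>)" unfolding N'(3)[symmetric] by auto
  qed
  ultimately have "AE u in \<mu>. u \<notin> (\<Union>U\<in>N'. U \<inter> space \<mu>)"
    by (auto dest: AE_not_in)
  with AE_space show ?thesis
    by eventually_elim (use \<open>space \<mu> - supp \<mu> \<subseteq> _\<close> in blast)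
qed

lemma AE_norm_le_supp: "AE u in \<mu>. norm u \<le> set_sup_norm (supp \<mu>)"
proof -
  have "bdd_above (norm ` X)"
    using compact_imp_bounded[OF compact_X] by (auto simp: bounded_iff bdd_above_def)
  then have "bdd_above (norm ` supp \<mu>)"
    by (rule bdd_above_mono) (auto simp: supp_def space_prior)
  then have "norm u \<le> set_sup_norm (supp \<mu>)" if "u \<in> supp \<mu>" for u
    using that unfolding set_sup_norm_def by (intro cSUP_upper)
  with AE_in_supp show ?thesis by (auto elim: eventually_mono)
qed

lemma mgf_pos: "0 < (\<integral>u. exp (y \<bullet> u) \<partial>\<mu>)"
proof -
  have "compact ((\<lambda>u. exp (y \<bullet> u)) ` X)" "(\<lambda>u. exp (y \<bullet> u)) ` X \<noteq> {}"
    using compact_X not_empty by (auto intro!: compact_continuous_image continuous_intros simp: space_prior)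
  then obtain u where u: "\<And>v. v \<in> X \<Longrightarrow> exp (y \<bullet> u) \<le> exp (y \<bullet> v)"
    using compact_attains_inf[of "(\<lambda>u. exp (y \<bullet> u)) ` X"] by auto
  have "exp (y \<bullet> u) \<le> (\<integral>u. exp (y \<bullet> u) \<partial>\<mu>)"
    by (intro integral_ge_const integrable_exp eventually_mono[OF AE_in_X] u)
  then show ?thesis by (rule less_le_trans[rotated]) simp
qed

lemma exp_log_mgf: "exp (log_mgf \<mu> y) = (\<integral>u. exp (y \<bullet> u) \<partial>\<mu>)"
  using mgf_pos by (simp add: log_mgf_def)

text \<open>
  Jensen's inequality for \<open>exp\<close>, obtained by integrating the tangent of \<open>exp\<close> at \<open>\<langle>w, E X\<rangle>\<close>.
\<close>
lemma log_mgf_ge_mean: "w \<bullet> (\<integral>u. u \<partial>\<mu>) \<le> log_mgf \<mu> w"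
proof -
  let ?c = "w \<bullet> (\<integral>u. u \<partial>\<mu>)"
  have "(\<integral>u. exp ?c * (1 + (w \<bullet> u - ?c)) \<partial>\<mu>) \<le> (\<integral>u. exp (w \<bullet> u) \<partial>\<mu>)"
  proof (rule integral_mono)
    show "exp ?c * (1 + (w \<bullet> u - ?c)) \<le> exp (w \<bullet> u)" for u
      using mult_left_mono[OF exp_ge_add_one_self[of "w \<bullet> u - ?c"], of "exp ?c"]
      by (simp flip: exp_add)
  qed (intro integrable_continuous continuous_intros)+
  also have "(\<integral>u. exp ?c * (1 + (w \<bullet> u - ?c)) \<partial>\<mu>) = exp ?c"
    using integrable_inner[of w] by (simp add: integral_inner prob_space)
  finally show ?thesis
    using mgf_pos unfolding log_mgf_def by (simp add: ln_ge_iff)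
qed

text \<open>
  Hoeffding's lemma for the random variable \<open>\<langle>w, u\<rangle>\<close>, which takes values in an interval of length
  \<open>2 R \<parallel>w\<parallel>\<close>; the constant \<open>(2 R)\<^sup>2 / 8\<close> there is exactly \<open>R\<^sup>2 / 2\<close>.
\<close>
lemma log_mgf_le_mean_quadratic:
  assumes "AE u in \<mu>. norm u \<le> R"
  shows "log_mgf \<mu> w \<le> w \<bullet> (\<integral>u. u \<partial>\<mu>) + R\<^sup>2 / 2 * (norm w)\<^sup>2"
proof -
  let ?c = "w \<bullet> (\<integral>u. u \<partial>\<mu>)"
  let ?a = "- R * norm w - ?c" and ?b = "R * norm w - ?c"
  interpret I: interval_bounded_random_variable \<mu> "\<lambda>u. w \<bullet> u - ?c" ?a ?b
  proof
    show "(\<lambda>u. w \<bullet> u - ?c) \<in> borel_measurable \<mu>"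
      using integrable_inner by auto
    show "AE u in \<mu>. w \<bullet> u - ?c \<in> {?a..?b}"
      using assms
    proof eventually_elim
      case (elim u)
      have "\<bar>w \<bullet> u\<bar> \<le> norm w * norm u" by (rule Cauchy_Schwarz_ineq2)
      also have "\<dots> \<le> R * norm w"
        using mult_left_mono[OF elim norm_ge_zero[of w]] by (simp add: mult.commute)
      finally show ?case by auto
    qed
  qed
  have int: "integrable \<mu> (\<lambda>u. exp (w \<bullet> u - ?c))"
    by (intro integrable_continuous continuous_intros)
  have "ennreal (\<integral>u. exp (w \<bullet> u - ?c) \<partial>\<mu>) = (\<integral>\<^sup>+u. exp (1 * (w \<bullet> u - ?c)) \<partial>\<mu>)"
    using nn_integral_eq_integral[OF int] by simp
  also have "\<dots> \<le> ennreal (exp (1\<^sup>2 * (?b - ?a)\<^sup>2 / 8))"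
    using integrable_inner[of w]
    by (intro I.Hoeffdings_lemma_nn_integral_0) (auto simp: integral_inner prob_space)
  also have "1\<^sup>2 * (?b - ?a)\<^sup>2 / 8 = R\<^sup>2 / 2 * (norm w)\<^sup>2"
    by (simp add: power2_eq_square algebra_simps)
  finally have "(\<integral>u. exp (w \<bullet> u - ?c) \<partial>\<mu>) \<le> exp (R\<^sup>2 / 2 * (norm w)\<^sup>2)"
    by (simp add: ennreal_le_iff)
  moreover have "(\<integral>u. exp (w \<bullet> u - ?c) \<partial>\<mu>) = exp (log_mgf \<mu> w - ?c)"
    by (simp add: exp_diff exp_log_mgf)
  ultimately show ?thesis by simp
qed

lemma integral_tilt:
  fixes f :: "real ^ 'm \<Rightarrow> 'b::{banach, second_countable_topology}"
  assumes f: "continuous_on UNIV f"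
  shows "(\<integral>u. f u \<partial>tilt \<mu> y) = (\<integral>u. exp (y \<bullet> u) *\<^sub>R f u \<partial>\<mu>) /\<^sub>R (\<integral>u. exp (y \<bullet> u) \<partial>\<mu>)"
proof -
  let ?Z = "\<integral>u. exp (y \<bullet> u) \<partial>\<mu>"
  have "(\<integral>u. f u \<partial>tilt \<mu> y) = (\<integral>u. (exp (y \<bullet> u) / ?Z) *\<^sub>R f u \<partial>\<mu>)"
    unfolding tilt_def using mgf_pos[of y]
    by (intro integral_density measurable_prior AE_I2 borel_measurable_continuous_onI f)
      (auto intro!: divide_nonneg_pos continuous_intros)
  also have "\<dots> = (\<integral>u. inverse ?Z *\<^sub>R (exp (y \<bullet> u) *\<^sub>R f u) \<partial>\<mu>)"
    by (simp add: divide_inverse mult.commute)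
  also have "\<dots> = inverse ?Z *\<^sub>R (\<integral>u. exp (y \<bullet> u) *\<^sub>R f u \<partial>\<mu>)"
    by (intro integral_scaleR_right integrable_continuous continuous_intros f)
  finally show ?thesis .
qed

lemma tilted_mean_eq:
  "tilted_mean \<mu> y = (\<integral>u. exp (y \<bullet> u) *\<^sub>R u \<partial>\<mu>) /\<^sub>R (\<integral>u. exp (y \<bullet> u) \<partial>\<mu>)"
  by (intro integral_tilt continuous_intros)

lemma measurable_tilt_density:
  "(\<lambda>u. ennreal (exp (y \<bullet> u) / (\<integral>v. exp (y \<bullet> v) \<partial>\<mu>))) \<in> borel_measurable \<mu>"
  by (rule measurable_prior) measurable

lemma AE_tilt: "(AE u in \<mu>. P u) \<Longrightarrow> AE u in tilt \<mu> y. P u"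
  unfolding tilt_def by (subst AE_density[OF measurable_tilt_density]) (auto elim: eventually_mono)

lemma compact_prior_tilt: "compact_prior (tilt \<mu> y) X"
proof -
  let ?Z = "\<integral>u. exp (y \<bullet> u) \<partial>\<mu>"
  have "emeasure (tilt \<mu> y) (space (tilt \<mu> y)) = (\<integral>\<^sup>+u. ennreal (exp (y \<bullet> u) / ?Z) \<partial>\<mu>)"
    unfolding tilt_def using measurable_tilt_density by (simp add: emeasure_density cong: nn_integral_cong)
  also have "\<dots> = ennreal (\<integral>u. exp (y \<bullet> u) / ?Z \<partial>\<mu>)"
    using integrable_exp mgf_pos[of y] by (intro nn_integral_eq_integral) auto
  also have "\<dots> = 1" using mgf_pos[of y] by simp
  finally have "prob_space (tilt \<mu> y)" by (rule prob_spaceI)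
  then show ?thesis
    using compact_X sets_prior
    by (simp add: compact_prior_iff borel_probs_def) (simp add: tilt_def)
qed

text \<open>
  Tilting turns a shift of the exponent into a change of measure. Everything known about \<open>log_mgf\<close> near
  \<open>0\<close> for all priors therefore transfers to arbitrary points.
\<close>
lemma log_mgf_add: "log_mgf \<mu> (y + w) = log_mgf \<mu> y + log_mgf (tilt \<mu> y) w"
proof -
  have "(\<integral>u. exp (w \<bullet> u) \<partial>tilt \<mu> y) = (\<integral>u. exp ((y + w) \<bullet> u) \<partial>\<mu>) / (\<integral>u. exp (y \<bullet> u) \<partial>\<mu>)"
    by (subst integral_tilt) (auto intro!: continuous_intros simp: exp_add inner_add_left divide_inverse mult.commute)
  then show ?thesis
    using mgf_pos[of y] mgf_pos[of "y + w"] by (simp add: log_mgf_def ln_div)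
qed

lemma log_mgf_ge_linear: "log_mgf \<mu> y + w \<bullet> tilted_mean \<mu> y \<le> log_mgf \<mu> (y + w)"
  using compact_prior.log_mgf_ge_mean[OF compact_prior_tilt] by (simp add: log_mgf_add)

lemma log_mgf_le_quadratic:
  assumes "AE u in \<mu>. norm u \<le> R"
  shows "log_mgf \<mu> (y + w) \<le> log_mgf \<mu> y + w \<bullet> tilted_mean \<mu> y + R\<^sup>2 / 2 * (norm w)\<^sup>2"
  using compact_prior.log_mgf_le_mean_quadratic[OF compact_prior_tilt AE_tilt[OF assms]]
  by (simp add: log_mgf_add add.assoc)

text \<open>
  The tilted mean is the gradient of \<open>log_mgf\<close>; the constant bounds the covariance of any tilt, as all of them
  live on the support of the prior.
\<close>
lemma tilted_mean_lipschitz: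
  "norm (tilted_mean \<mu> x - tilted_mean \<mu> y) \<le> (set_sup_norm (supp \<mu>))\<^sup>2 * norm (x - y)"
  by (rule lipschitz_gradient_of_quadratic_bounds[where L = "log_mgf \<mu>"])
    (simp_all only: log_mgf_ge_linear log_mgf_le_quadratic[OF AE_norm_le_supp] zero_le_power2)

end

section \<open>Relative entropy: the Donsker--Varadhan inequality\<close>

lemma enn2ereal_pos_neg_parts:
  fixes h :: "'a \<Rightarrow> real"
  assumes "integrable M h"
  obtains p n where "0 \<le> p" "0 \<le> n" "(\<integral>\<^sup>+u. ennreal (h u) \<partial>M) = ennreal p"
    "(\<integral>\<^sup>+u. ennreal (- h u) \<partial>M) = ennreal n" "(\<integral>u. h u \<partial>M) = p - n"
proof -
  have "(\<integral>\<^sup>+u. ennreal (h u) \<partial>M) \<noteq> \<infinity>" "(\<integral>\<^sup>+u. ennreal (- h u) \<partial>M) \<noteq> \<infinity>"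
    using assms by (auto simp: real_integrable_def)
  then show thesis
    using real_lebesgue_integral_def[OF assms]
    by (intro that[of "enn2real (\<integral>\<^sup>+u. ennreal (h u) \<partial>M)" "enn2real (\<integral>\<^sup>+u. ennreal (- h u) \<partial>M)"])
      (auto simp: less_top)
qed

text \<open>
  The right-hand side is the extended integral in the definition of \<open>KL\<close>. An integrable minorant makes the
  negative part finite and bounds the difference from below, even if the positive part is infinite.
\<close>
lemma integral_le_extended_integral:
  fixes h l :: "'a \<Rightarrow> real"
  assumes "integrable M h" and "AE u in M. h u \<le> l u"
  shows "ereal (\<integral>u. h u \<partial>M)
    \<le> enn2ereal (\<integral>\<^sup>+u. ennreal (l u) \<partial>M) - enn2ereal (\<integral>\<^sup>+u. ennreal (- l u) \<partial>M)"
proof -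
  obtain p n where pn: "0 \<le> p" "0 \<le> n" "(\<integral>\<^sup>+u. ennreal (h u) \<partial>M) = ennreal p"
    "(\<integral>\<^sup>+u. ennreal (- h u) \<partial>M) = ennreal n" "(\<integral>u. h u \<partial>M) = p - n"
    by (rule enn2ereal_pos_neg_parts[OF assms(1)])
  have "ennreal p \<le> (\<integral>\<^sup>+u. ennreal (l u) \<partial>M)"
    unfolding pn(3)[symmetric] using assms(2)
    by (intro nn_integral_mono_AE) (auto elim!: eventually_mono intro: ennreal_leI)
  then have "ereal p \<le> enn2ereal (\<integral>\<^sup>+u. ennreal (l u) \<partial>M)"
    using pn(1) by (simp add: less_eq_ennreal.rep_eq)
  moreover have "(\<integral>\<^sup>+u. ennreal (- l u) \<partial>M) \<le> ennreal n"
    unfolding pn(4)[symmetric] using assms(2)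
    by (intro nn_integral_mono_AE) (auto elim!: eventually_mono intro: ennreal_leI)
  then have "enn2ereal (\<integral>\<^sup>+u. ennreal (- l u) \<partial>M) \<le> ereal n"
    using pn(2) by (simp add: less_eq_ennreal.rep_eq)
  ultimately have "ereal p - ereal n
      \<le> enn2ereal (\<integral>\<^sup>+u. ennreal (l u) \<partial>M) - enn2ereal (\<integral>\<^sup>+u. ennreal (- l u) \<partial>M)"
    by (rule ereal_minus_mono)
  then show ?thesis by (simp add: pn(5))
qed

lemma integral_eq_extended_integral:
  fixes h :: "'a \<Rightarrow> real"
  assumes "integrable M h"
  shows "enn2ereal (\<integral>\<^sup>+u. ennreal (h u) \<partial>M) - enn2ereal (\<integral>\<^sup>+u. ennreal (- h u) \<partial>M)
    = ereal (\<integral>u. h u \<partial>M)"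
  by (rule enn2ereal_pos_neg_parts[OF assms]) simp

context compact_prior
begin

text \<open>
  The Donsker--Varadhan inequality. With \<open>r = dQ/d\<mu>\<close> and \<open>e = exp (\<langle>y, u\<rangle> - L(y)) / r\<close>, the inequality
  \<open>ln e \<le> e - 1\<close> reads \<open>ln r \<ge> \<langle>y, u\<rangle> - L(y) + 1 - e\<close>. The \<open>Q\<close>-integral of \<open>e\<close> is the \<open>\<mu>\<close>-integral of
  \<open>exp (\<langle>y, u\<rangle> - L(y))\<close> over \<open>{r > 0}\<close>, hence at most 1, so integrating this minorant against \<open>Q\<close> gives the claim.
\<close>
lemma KL_ge:
  assumes Q: "Q \<in> borel_probs X"
  shows "ereal (y \<bullet> (\<integral>u. u \<partial>Q) - log_mgf \<mu> y) \<le> KL Q \<mu>"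
proof (cases "absolutely_continuous \<mu> Q")
  case False
  then show ?thesis by (simp add: KL_def)
next
  case ac: True
  interpret Q: compact_prior Q X
    using Q compact_X by (simp add: compact_prior_iff)
  have sets_Q: "sets Q = sets \<mu>" using sets_prior Q.sets_prior by simp
  define r where "r u = enn2real (RN_deriv \<mu> Q u)" for u
  define c where "c = log_mgf \<mu> y"
  define e where "e u = exp (y \<bullet> u - c) / r u" for u
  define h where "h u = y \<bullet> u - c + 1 - e u" for u
  have r_nonneg: "0 \<le> r u" for u by (simp add: r_def)
  have r_meas: "r \<in> borel_measurable \<mu>" unfolding r_def by measurable
  have exp_meas: "(\<lambda>u. exp (y \<bullet> u - c)) \<in> borel_measurable \<mu>"
    by (rule measurable_prior) measurable
  have e_meas: "e \<in> borel_measurable \<mu>" unfolding e_def using r_meas exp_meas by measurable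
  have exp_int: "integrable \<mu> (\<lambda>u. exp (y \<bullet> u - c))"
    by (intro integrable_continuous continuous_intros)
  have "AE u in \<mu>. RN_deriv \<mu> Q u \<noteq> \<infinity>"
    by (rule RN_deriv_finite[OF Q.sigma_finite_measure_axioms ac sets_Q])
  then have "AE u in \<mu>. RN_deriv \<mu> Q u = ennreal (r u)"
    by eventually_elim (simp add: r_def less_top)
  then have "density \<mu> (RN_deriv \<mu> Q) = density \<mu> (\<lambda>u. ennreal (r u))"
    using r_meas by (intro density_cong) auto
  then have Q_eq: "Q = density \<mu> (\<lambda>u. ennreal (r u))"
    using density_RN_deriv[OF ac sets_Q] by simp
  have r_pos: "AE u in Q. 0 < r u"
    unfolding Q_eq using r_meas by (subst AE_density) auto
  \<comment> \<open>Equality where \<open>r > 0\<close>; where \<open>r = 0\<close> the product vanishes, as \<open>e\<close> is 0 there by division by zero.\<close>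
  have re_le: "r u *\<^sub>R e u \<le> exp (y \<bullet> u - c)" "0 \<le> r u *\<^sub>R e u" for u
    using r_nonneg[of u] by (auto simp: e_def)
  have re_int: "integrable \<mu> (\<lambda>u. r u *\<^sub>R e u)"
    using re_le r_meas e_meas by (intro Bochner_Integration.integrable_bound[OF exp_int]) auto
  have e_int: "integrable Q e"
    unfolding Q_eq using r_meas e_meas r_nonneg re_int by (subst integrable_density) auto
  have "(\<integral>u. e u \<partial>Q) = (\<integral>u. r u *\<^sub>R e u \<partial>\<mu>)"
    unfolding Q_eq using r_meas e_meas r_nonneg by (subst integral_density) auto
  also have "\<dots> \<le> (\<integral>u. exp (y \<bullet> u - c) \<partial>\<mu>)"
    using re_le by (intro integral_mono re_int exp_int)
  also have "\<dots> = 1"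
    using mgf_pos[of y] by (simp add: exp_diff c_def exp_log_mgf)
  finally have e_le: "(\<integral>u. e u \<partial>Q) \<le> 1" .
  have h_int: "integrable Q h"
    unfolding h_def using e_int Q.integrable_inner by auto
  have "AE u in Q. h u \<le> ln (enn2real (RN_deriv \<mu> Q u))"
    using r_pos
  proof eventually_elim
    case (elim u)
    have "ln (e u) \<le> e u - 1"
      using elim by (intro ln_le_minus_one) (simp add: e_def)
    moreover have "ln (e u) = y \<bullet> u - c - ln (r u)"
      using elim by (simp add: e_def ln_div)
    ultimately show ?case by (simp add: h_def r_def)
  qed
  then have "ereal (\<integral>u. h u \<partial>Q) \<le> KL Q \<mu>"
    using integral_le_extended_integral[OF h_int] ac by (simp add: KL_def)
  moreover have "y \<bullet> (\<integral>u. u \<partial>Q) - c \<le> (\<integral>u. h u \<partial>Q)"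
    unfolding h_def using e_int Q.integrable_inner[of y] e_le
    by (simp add: Q.integral_inner Q.prob_space)
  ultimately show ?thesis
    unfolding c_def by (meson ereal_less_eq(3) order_trans)
qed

text \<open>
  The logarithm of the density of a tilt is \<open>\<langle>y, u\<rangle> - L(y)\<close>, a bounded function on \<open>X\<close>, so the
  extended integral is an ordinary one.
\<close>
lemma KL_tilt: "KL (tilt \<mu> y) \<mu> = ereal (y \<bullet> tilted_mean \<mu> y - log_mgf \<mu> y)"
proof -
  interpret T: compact_prior "tilt \<mu> y" X by (rule compact_prior_tilt)
  have ac: "absolutely_continuous \<mu> (tilt \<mu> y)"
    unfolding tilt_def by (rule absolutely_continuousI_density[OF measurable_tilt_density])
  have "AE u in \<mu>. ennreal (exp (y \<bullet> u) / (\<integral>v. exp (y \<bullet> v) \<partial>\<mu>)) = RN_deriv \<mu> (tilt \<mu> y) u"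
    by (rule RN_deriv_unique[OF measurable_tilt_density]) (simp add: tilt_def)
  then have "AE u in tilt \<mu> y. ln (enn2real (RN_deriv \<mu> (tilt \<mu> y) u)) = y \<bullet> u - log_mgf \<mu> y"
  proof (rule AE_tilt[OF eventually_mono])
    fix u assume "ennreal (exp (y \<bullet> u) / (\<integral>v. exp (y \<bullet> v) \<partial>\<mu>)) = RN_deriv \<mu> (tilt \<mu> y) u"
    from this[symmetric] show "ln (enn2real (RN_deriv \<mu> (tilt \<mu> y) u)) = y \<bullet> u - log_mgf \<mu> y"
      using mgf_pos[of y] by (simp add: ln_div log_mgf_def)
  qed
  then have "KL (tilt \<mu> y) \<mu>
      = enn2ereal (\<integral>\<^sup>+u. ennreal (y \<bullet> u - log_mgf \<mu> y) \<partial>tilt \<mu> y)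
        - enn2ereal (\<integral>\<^sup>+u. ennreal (- (y \<bullet> u - log_mgf \<mu> y)) \<partial>tilt \<mu> y)"
    unfolding KL_def using ac
    by (simp only: if_True) (intro arg_cong2[where f = minus] arg_cong[where f = enn2ereal]
      nn_integral_cong_AE; auto elim!: eventually_mono)+
  also have "\<dots> = ereal (\<integral>u. y \<bullet> u - log_mgf \<mu> y \<partial>tilt \<mu> y)"
    by (intro integral_eq_extended_integral T.integrable_continuous continuous_intros)
  also have "(\<integral>u. y \<bullet> u - log_mgf \<mu> y \<partial>tilt \<mu> y) = y \<bullet> tilted_mean \<mu> y - log_mgf \<mu> y"
    using T.integrable_inner[of y] by (simp add: T.integral_inner T.prob_space)
  finally show ?thesis .
qed

text \<open>
  Weak duality for \<open>kappa_prior\<close>, which at a tilted mean is attained by the tilt itself (next lemma).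
\<close>
lemma kappa_prior_ge: "ereal (y \<bullet> x - log_mgf \<mu> y) \<le> kappa_prior X \<mu> x"
  unfolding kappa_prior_def by (rule INF_greatest) (use KL_ge in auto)

lemma kappa_prior_tilted_mean_le:
  "kappa_prior X \<mu> (tilted_mean \<mu> y) \<le> ereal (y \<bullet> tilted_mean \<mu> y - log_mgf \<mu> y)"
  unfolding kappa_prior_def KL_tilt[symmetric]
  using compact_prior_tilt compact_X by (intro INF_lower) (simp add: compact_prior_iff)

end

section \<open>Optimality conditions of the dual and the primal problem\<close>

context compact_prior
begin

lemma log_mgf_le_along_ray:
  "log_mgf \<mu> (y + t *\<^sub>R d) \<le> log_mgf \<mu> y + t * (d \<bullet> tilted_mean \<mu> y)
    + t\<^sup>2 * ((set_sup_norm (supp \<mu>))\<^sup>2 / 2 * (norm d)\<^sup>2)"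
  using log_mgf_le_quadratic[OF AE_norm_le_supp, of y "t *\<^sub>R d"]
  by (simp add: power_mult_distrib mult_ac)

text \<open>
  Put \<open>p = -z/\<alpha>\<close> and \<open>q = \<nabla>g(w)\<close>. The conjugate is finite at every gradient of \<open>g\<close>, so minimality of
  \<open>z\<close> forces it to be finite at \<open>p\<close>; at \<open>q\<close> its value is \<open>g\<^sup>*(q) = \<langle>q, w\<rangle> - g(w)\<close>. Moving from \<open>p\<close> towards \<open>q\<close>, convexity of \<open>g\<^sup>*\<close> and the quadratic bound
  on \<open>L\<close> give \<open>g\<^sup>*(q) \<ge> g\<^sup>*(p) + \<langle>w, q - p\<rangle>\<close> to first order. Inserting the value of \<open>g\<^sup>*(q)\<close> yields
  \<open>g(w) + g\<^sup>*(p) \<le> \<langle>p, w\<rangle>\<close>, the equality case of Fenchel--Young, which says that \<open>p\<close> is a subgradient of \<open>g\<close> at \<open>w\<close>.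
\<close>
lemma solves_dual_imp_subgradient:
  fixes A :: "real ^ 'm ^ 'd" and g :: "real ^ 'd \<Rightarrow> real"
  assumes "\<alpha> > 0" and "convex_on UNIV g" and grad: "\<And>w. GDERIV g w :> grad_g w"
    and dual: "solves_dual A b \<alpha> g \<mu> z"
  defines "w \<equiv> A *v tilted_mean \<mu> (transpose A *v z) - b"
  shows "g v \<ge> g w + (- z /\<^sub>R \<alpha>) \<bullet> (v - w)"
proof -
  let ?m = "tilted_mean \<mu> (transpose A *v z)"
  let ?L = "\<lambda>z. log_mgf \<mu> (transpose A *v z)"
  have tangent: "g y \<ge> g x + grad_g x \<bullet> (y - x)" for x y
    by (rule convex_gradient_inequality[OF assms(2) grad])
  have conj_grad: "fenchel_conjugate g (grad_g x) \<le> ereal (grad_g x \<bullet> x - g x)" for x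
    unfolding fenchel_conjugate_def
  proof (rule SUP_least)
    fix y show "ereal (grad_g x \<bullet> y - g y) \<le> ereal (grad_g x \<bullet> x - g x)"
      using tangent[of x y] by (simp add: inner_diff_right)
  qed
  have conj_ge: "ereal (q \<bullet> x - g x) \<le> fenchel_conjugate g q" for q x
    unfolding fenchel_conjugate_def by (rule SUP_upper) simp
  have dual_le: "dual_objective A b \<alpha> g \<mu> z \<le> dual_objective A b \<alpha> g \<mu> z'" for z'
    using dual unfolding solves_dual_def is_arg_min_def by (auto simp: not_less)
  have dual_bound: "dual_objective A b \<alpha> g \<mu> (- \<alpha> *\<^sub>R q) \<le> ereal (\<alpha> * s + b \<bullet> (\<alpha> *\<^sub>R q) + ?L (- \<alpha> *\<^sub>R q))"
    if "fenchel_conjugate g q \<le> ereal s" for q s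
  proof -
    have "ereal \<alpha> * fenchel_conjugate g q \<le> ereal (\<alpha> * s)"
      using ereal_mult_left_mono[OF that, of "ereal \<alpha>"] \<open>\<alpha> > 0\<close> by simp
    moreover have "- (- \<alpha> *\<^sub>R q) /\<^sub>R \<alpha> = q" using \<open>\<alpha> > 0\<close> by simp
    ultimately show ?thesis
      unfolding dual_objective_def
      by (cases "ereal \<alpha> * fenchel_conjugate g q") auto
  qed
  define p where "p = - z /\<^sub>R \<alpha>"
  have z: "z = - \<alpha> *\<^sub>R p" using \<open>\<alpha> > 0\<close> by (simp add: p_def)
  have "fenchel_conjugate g p \<noteq> \<infinity>"
  proof
    assume "fenchel_conjugate g p = \<infinity>"
    then have "dual_objective A b \<alpha> g \<mu> z = \<infinity>"
      using \<open>\<alpha> > 0\<close> unfolding dual_objective_def p_def[symmetric] by simp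
    then show False
      using dual_le[of "- \<alpha> *\<^sub>R grad_g 0"] dual_bound[OF conj_grad[of 0]] by simp
  qed
  moreover have "fenchel_conjugate g p \<noteq> - \<infinity>" using conj_ge[of p 0] by auto
  ultimately obtain s where s: "fenchel_conjugate g p = ereal s"
    by (cases "fenchel_conjugate g p") auto
  \<comment> \<open>In terms of \<open>z\<close>, the segment from \<open>p\<close> to \<open>q\<close> is traversed in the direction \<open>d\<close>; \<open>C\<close> bounds the curvature of \<open>L\<close> along it.\<close>
  define q where "q = grad_g w"
  define d where "d = \<alpha> *\<^sub>R (p - q)"
  define C where "C = (set_sup_norm (supp \<mu>))\<^sup>2 / 2 * (norm (transpose A *v d))\<^sup>2"
  have "0 \<le> t * (\<alpha> * (q \<bullet> w - g w - s + (p - q) \<bullet> w)) + t\<^sup>2 * C"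
    if t: "0 < t" "t \<le> 1" for t
  proof -
    define pt where "pt = (1 - t) *\<^sub>R p + t *\<^sub>R q"
    have "fenchel_conjugate g pt \<le> ereal ((1 - t) * s + t * (q \<bullet> w - g w))"
      unfolding fenchel_conjugate_def
    proof (rule SUP_least)
      fix y
      have "(1 - t) * (p \<bullet> y - g y) \<le> (1 - t) * s"
        using conj_ge[of p y] t by (intro mult_left_mono) (auto simp: s)
      moreover have "t * (q \<bullet> y - g y) \<le> t * (q \<bullet> w - g w)"
        using tangent[of w y] t by (intro mult_left_mono) (auto simp: q_def inner_diff_right)
      moreover have "pt \<bullet> y - g y = (1 - t) * (p \<bullet> y - g y) + t * (q \<bullet> y - g y)"
        by (simp add: pt_def inner_add_left algebra_simps)
      ultimately show "ereal (pt \<bullet> y - g y) \<le> ereal ((1 - t) * s + t * (q \<bullet> w - g w))"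
        by simp
    qed
    from dual_bound[OF this] dual_le
    have "dual_objective A b \<alpha> g \<mu> z \<le> ereal (\<alpha> * ((1 - t) * s + t * (q \<bullet> w - g w))
        + b \<bullet> (\<alpha> *\<^sub>R pt) + ?L (- \<alpha> *\<^sub>R pt))"
      using order_trans by blast
    then have opt: "\<alpha> * s - b \<bullet> z + ?L z
        \<le> \<alpha> * ((1 - t) * s + t * (q \<bullet> w - g w)) + b \<bullet> (\<alpha> *\<^sub>R pt) + ?L (- \<alpha> *\<^sub>R pt)"
      unfolding dual_objective_def p_def[symmetric] s by simp
    have pt: "- \<alpha> *\<^sub>R pt = z + t *\<^sub>R d"
      by (simp add: z pt_def d_def algebra_simps)
    have ray: "?L (z + t *\<^sub>R d) \<le> ?L z + t * ((transpose A *v d) \<bullet> ?m) + t\<^sup>2 * C"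
      using log_mgf_le_along_ray[of "transpose A *v z" t "transpose A *v d"]
      by (simp only: C_def matrix_vector_right_distrib matrix_vector_mult_scaleR)
    have "(transpose A *v d) \<bullet> ?m = d \<bullet> (A *v ?m)"
      by (simp add: dot_lmul_matrix transpose_matrix_vector)
    also have "A *v ?m = w + b" by (simp add: w_def)
    also have "d \<bullet> (w + b) = \<alpha> * ((p - q) \<bullet> w) + d \<bullet> b"
      by (simp add: d_def inner_add_right)
    finally have slope: "(transpose A *v d) \<bullet> ?m = \<alpha> * ((p - q) \<bullet> w) + d \<bullet> b" .
    have "\<alpha> *\<^sub>R pt = - (z + t *\<^sub>R d)" using pt by (metis minus_minus scaleR_minus_left)
    then have "b \<bullet> (\<alpha> *\<^sub>R pt) = - (b \<bullet> z) - t * (d \<bullet> b)"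
      by (simp add: inner_diff_right inner_commute[of d b])
    with opt ray have "0 \<le> \<alpha> * ((1 - t) * s + t * (q \<bullet> w - g w)) - \<alpha> * s - t * (d \<bullet> b)
        + t * ((transpose A *v d) \<bullet> ?m) + t\<^sup>2 * C"
      unfolding pt by linarith
    also have "\<dots> = t * (\<alpha> * (q \<bullet> w - g w - s + (p - q) \<bullet> w)) + t\<^sup>2 * C"
      unfolding slope by (simp add: algebra_simps)
    finally show ?thesis .
  qed
  then have "0 \<le> \<alpha> * (q \<bullet> w - g w - s + (p - q) \<bullet> w)" by (rule first_order_nonneg)
  then have "0 \<le> q \<bullet> w - g w - s + (p - q) \<bullet> w"
    using \<open>\<alpha> > 0\<close> by (simp add: zero_le_mult_iff)
  moreover have "p \<bullet> v - g v \<le> s" using conj_ge[of p v] by (simp add: s)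
  ultimately show ?thesis
    unfolding p_def[symmetric] by (simp add: inner_diff_left inner_diff_right)
qed

text \<open>
  With \<open>y = A\<^sup>T z\<close>, the subgradient inequality for \<open>g\<close> and \<open>\<kappa>(x) \<ge> \<langle>y, x\<rangle> - L(y)\<close> already show that no \<open>x\<close> does
  better than \<open>m z\<close>, since the two linear terms cancel. For uniqueness, use the exponent \<open>y + t (x - m z)\<close> instead:
  because \<open>L\<close> has slope \<open>m z\<close> at \<open>y\<close>, the lower bound for \<open>\<kappa>(x)\<close> improves by \<open>t \<parallel>x - m z\<parallel>\<^sup>2\<close> up to second order
  in \<open>t\<close>, which is impossible at a minimiser unless \<open>x = m z\<close>.
\<close>
lemma solves_primal_imp_tilted_mean:
  fixes A :: "real ^ 'm ^ 'd" and g :: "real ^ 'd \<Rightarrow> real"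
  defines "m z \<equiv> tilted_mean \<mu> (transpose A *v z)"
  assumes "\<alpha> > 0"
    and sub: "\<And>v. g v \<ge> g (A *v m z - b) + (- z /\<^sub>R \<alpha>) \<bullet> (v - (A *v m z - b))"
    and primal: "solves_primal X A b \<alpha> g \<mu> x"
  shows "x = m z"
proof -
  let ?y = "transpose A *v z" and ?d = "x - m z"
  have "0 \<le> t * (- (?d \<bullet> ?d)) + t\<^sup>2 * ((set_sup_norm (supp \<mu>))\<^sup>2 / 2 * (norm ?d)\<^sup>2)"
    if t: "0 < t" "t \<le> 1" for t
  proof -
    have "ereal (\<alpha> * g (A *v x - b) + ((?y + t *\<^sub>R ?d) \<bullet> x - log_mgf \<mu> (?y + t *\<^sub>R ?d)))
        \<le> primal_objective X A b \<alpha> g \<mu> x"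
      unfolding primal_objective_def plus_ereal.simps(1)[symmetric]
      by (intro add_left_mono kappa_prior_ge)
    also have "\<dots> \<le> primal_objective X A b \<alpha> g \<mu> (m z)"
      using primal unfolding solves_primal_def is_arg_min_def by (auto simp: not_less)
    also have "\<dots> \<le> ereal (\<alpha> * g (A *v m z - b) + (?y \<bullet> m z - log_mgf \<mu> ?y))"
      unfolding primal_objective_def plus_ereal.simps(1)[symmetric] m_def
      by (intro add_left_mono kappa_prior_tilted_mean_le)
    finally have "\<alpha> * g (A *v x - b) + ((?y + t *\<^sub>R ?d) \<bullet> x - log_mgf \<mu> (?y + t *\<^sub>R ?d))
        \<le> \<alpha> * g (A *v m z - b) + (?y \<bullet> m z - log_mgf \<mu> ?y)" by simp
    moreover have "\<alpha> * g (A *v x - b) \<ge> \<alpha> * g (A *v m z - b) - ?y \<bullet> ?d"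
    proof -
      have "\<alpha> * (g (A *v m z - b) + (- z /\<^sub>R \<alpha>) \<bullet> (A *v ?d)) \<le> \<alpha> * g (A *v x - b)"
        using sub[of "A *v x - b"] \<open>\<alpha> > 0\<close>
        by (intro mult_left_mono) (auto simp: matrix_vector_mult_diff_distrib)
      moreover have "?y \<bullet> ?d = z \<bullet> (A *v ?d)"
        by (simp add: dot_lmul_matrix transpose_matrix_vector)
      moreover have "\<alpha> * (g (A *v m z - b) + (- z /\<^sub>R \<alpha>) \<bullet> (A *v ?d))
          = \<alpha> * g (A *v m z - b) - z \<bullet> (A *v ?d)"
        using \<open>\<alpha> > 0\<close> by (simp add: right_diff_distrib)
      ultimately show ?thesis by linarith
    qed
    moreover have "log_mgf \<mu> (?y + t *\<^sub>R ?d) \<le> log_mgf \<mu> ?y + t * (?d \<bullet> m z)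
        + t\<^sup>2 * ((set_sup_norm (supp \<mu>))\<^sup>2 / 2 * (norm ?d)\<^sup>2)"
      unfolding m_def by (rule log_mgf_le_along_ray)
    moreover have "(?y + t *\<^sub>R ?d) \<bullet> x = ?y \<bullet> m z + ?y \<bullet> ?d + t * (?d \<bullet> m z) + t * (?d \<bullet> ?d)"
      by (simp add: inner_add_left inner_diff_right algebra_simps)
    ultimately show ?thesis by linarith
  qed
  then have "0 \<le> - (?d \<bullet> ?d)" by (rule first_order_nonneg)
  then have "?d \<bullet> ?d = 0" using inner_ge_zero[of ?d] by linarith
  then show ?thesis by simp
qed

end

section \<open>Stability of the primal solution\<close>

text \<open>
  With \<open>m\<^sub>i = N\<^sub>i / Z\<^sub>i\<close>, the difference is \<open>m\<^sub>1 (Z\<^sub>2 - Z\<^sub>1) / Z\<^sub>2 + (N\<^sub>1 - N\<^sub>2) / Z\<^sub>2\<close>.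
\<close>
lemma (in compact_prior) tilted_mean_prior_change:
  assumes "compact_prior \<nu> X"
  shows "norm (tilted_mean \<mu> y - tilted_mean \<nu> y)
    \<le> norm (tilted_mean \<mu> y) * inverse (\<integral>u. exp (y \<bullet> u) \<partial>\<nu>)
        * \<bar>(\<integral>u. exp (y \<bullet> u) \<partial>\<nu>) - (\<integral>u. exp (y \<bullet> u) \<partial>\<mu>)\<bar>
      + inverse (\<integral>u. exp (y \<bullet> u) \<partial>\<nu>)
        * norm ((\<integral>u. exp (y \<bullet> u) *\<^sub>R u \<partial>\<mu>) - (\<integral>u. exp (y \<bullet> u) *\<^sub>R u \<partial>\<nu>))"
proof -
  interpret N: compact_prior \<nu> X by fact
  define Z1 where "Z1 = (\<integral>u. exp (y \<bullet> u) \<partial>\<mu>)"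
  define Z2 where "Z2 = (\<integral>u. exp (y \<bullet> u) \<partial>\<nu>)"
  define N1 where "N1 = (\<integral>u. exp (y \<bullet> u) *\<^sub>R u \<partial>\<mu>)"
  define N2 where "N2 = (\<integral>u. exp (y \<bullet> u) *\<^sub>R u \<partial>\<nu>)"
  have Z: "Z1 > 0" "Z2 > 0" using mgf_pos N.mgf_pos by (auto simp: Z1_def Z2_def)
  have m1: "tilted_mean \<mu> y = N1 /\<^sub>R Z1" and m2: "tilted_mean \<nu> y = N2 /\<^sub>R Z2"
    by (simp_all add: tilted_mean_eq N.tilted_mean_eq Z1_def Z2_def N1_def N2_def)
  have N1: "N1 = Z1 *\<^sub>R tilted_mean \<mu> y" using Z by (simp add: m1)
  have "tilted_mean \<mu> y - tilted_mean \<nu> y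
      = (inverse Z2 * (Z2 - Z1)) *\<^sub>R tilted_mean \<mu> y + inverse Z2 *\<^sub>R (N1 - N2)"
    unfolding m2 N1 using Z by (simp add: algebra_simps)
  also have "norm \<dots> \<le> norm ((inverse Z2 * (Z2 - Z1)) *\<^sub>R tilted_mean \<mu> y) + norm (inverse Z2 *\<^sub>R (N1 - N2))"
    by (rule norm_triangle_ineq)
  also have "\<dots> = norm (tilted_mean \<mu> y) * inverse Z2 * \<bar>Z2 - Z1\<bar> + inverse Z2 * norm (N1 - N2)"
    using Z by (simp add: abs_mult)
  finally show ?thesis by (simp only: Z1_def Z2_def N1_def N2_def)
qed

theorem proposition3p13:
  fixes X :: "(real ^ 'm) set" and A :: "real ^ 'm ^ 'd" and b :: "real ^ 'd"
    and \<alpha> \<beta> :: real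
    and g :: "real ^ 'd \<Rightarrow> real" and grad_g :: "real ^ 'd \<Rightarrow> real ^ 'd"
    and \<rho> \<eta> :: "(real ^ 'm) measure"
    and x\<rho> x\<eta> :: "real ^ 'm" and z\<rho> z\<eta> :: "real ^ 'd"
  assumes "compact X"
    and "\<alpha> > 0" and "\<beta> > 0"
    and "convex_on UNIV g"
    and "\<And>w. GDERIV g w :> grad_g w"
    and "lipschitz_on (1 / \<beta>) UNIV grad_g"
    and "\<rho> \<in> borel_probs X" and "\<eta> \<in> borel_probs X"
    and "solves_primal X A b \<alpha> g \<rho> x\<rho>" and "solves_primal X A b \<alpha> g \<eta> x\<eta>"
    and "solves_dual A b \<alpha> g \<rho> z\<rho>" and "solves_dual A b \<alpha> g \<eta> z\<eta>"
  shows "(norm (x\<rho> - x\<eta>) \<le>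
           (op_norm A * (set_sup_norm (supp \<rho>))\<^sup>2) * norm (z\<rho> - z\<eta>)
           + kappa' A (mat 1 :: real ^ 'm ^ 'm) \<rho> \<eta> z\<eta> *
             \<bar>(\<integral>u. exp ((transpose A *v z\<eta>) \<bullet> u) \<partial>\<eta>)
               - (\<integral>u. exp ((transpose A *v z\<eta>) \<bullet> u) \<partial>\<rho>)\<bar>
           + zeta' A (mat 1 :: real ^ 'm ^ 'm) \<rho> \<eta> z\<eta> *
             norm ((\<integral>u. exp ((transpose A *v z\<eta>) \<bullet> u) *\<^sub>R u \<partial>\<rho>)
               - (\<integral>u. exp ((transpose A *v z\<eta>) \<bullet> u) *\<^sub>R u \<partial>\<eta>)))
    \<and> (\<forall>\<gamma>. inj (\<lambda>x. A *v x) \<and> \<gamma> > 0 \<and> strongly_convex (1 / \<gamma>) g \<longrightarrow>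
           norm (x\<rho> - x\<eta>) \<le> \<gamma> / (\<alpha> * sigma_min A) * norm (z\<rho> - z\<eta>))"
proof (intro conjI allI impI; (elim conjE)?)
  interpret R: compact_prior \<rho> X using assms(1,7) by (simp add: compact_prior_iff)
  interpret E: compact_prior \<eta> X using assms(1,8) by (simp add: compact_prior_iff)
  let ?y\<rho> = "transpose A *v z\<rho>" and ?y\<eta> = "transpose A *v z\<eta>"
  note subgradient_\<rho> = R.solves_dual_imp_subgradient[OF assms(2,4,5,11)]
  note subgradient_\<eta> = E.solves_dual_imp_subgradient[OF assms(2,4,5,12)]
  have x\<rho>: "x\<rho> = tilted_mean \<rho> ?y\<rho>"
    by (rule R.solves_primal_imp_tilted_mean[OF assms(2) subgradient_\<rho> assms(9)])
  have x\<eta>: "x\<eta> = tilted_mean \<eta> ?y\<eta>"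
    by (rule E.solves_primal_imp_tilted_mean[OF assms(2) subgradient_\<eta> assms(10)])
  {
    have "norm (tilted_mean \<rho> ?y\<rho> - tilted_mean \<rho> ?y\<eta>)
        \<le> (set_sup_norm (supp \<rho>))\<^sup>2 * norm (transpose A *v (z\<rho> - z\<eta>))"
      using R.tilted_mean_lipschitz[of ?y\<rho> ?y\<eta>] by (simp only: matrix_vector_mult_diff_distrib)
    also have "\<dots> \<le> (set_sup_norm (supp \<rho>))\<^sup>2 * (op_norm A * norm (z\<rho> - z\<eta>))"
      by (intro mult_left_mono norm_transpose_vector_le) simp
    finally have dual_part: "norm (tilted_mean \<rho> ?y\<rho> - tilted_mean \<rho> ?y\<eta>)
        \<le> (op_norm A * (set_sup_norm (supp \<rho>))\<^sup>2) * norm (z\<rho> - z\<eta>)"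
      by (simp only: mult_ac)
    let ?dZ = "\<bar>(\<integral>u. exp (?y\<eta> \<bullet> u) \<partial>\<eta>) - (\<integral>u. exp (?y\<eta> \<bullet> u) \<partial>\<rho>)\<bar>"
    let ?dN = "norm ((\<integral>u. exp (?y\<eta> \<bullet> u) *\<^sub>R u \<partial>\<rho>) - (\<integral>u. exp (?y\<eta> \<bullet> u) *\<^sub>R u \<partial>\<eta>))"
    have "norm (tilted_mean \<rho> ?y\<eta> - tilted_mean \<eta> ?y\<eta>)
        \<le> kappa A (mat 1 :: real ^ 'm ^ 'm) \<rho> \<eta> z\<eta> * ?dZ + zeta A (mat 1 :: real ^ 'm ^ 'm) \<eta> z\<eta> * ?dN"
      using R.tilted_mean_prior_change[OF E.compact_prior_axioms, of ?y\<eta>]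
      unfolding kappa_def zeta_def op_norm_mat_1 gibbs_eq_tilt partition_fun_def mult_1 .
    also have "\<dots> \<le> kappa' A (mat 1 :: real ^ 'm ^ 'm) \<rho> \<eta> z\<eta> * ?dZ
        + zeta' A (mat 1 :: real ^ 'm ^ 'm) \<rho> \<eta> z\<eta> * ?dN"
      unfolding kappa'_def zeta'_def by (intro add_mono mult_right_mono) auto
    finally show "norm (x\<rho> - x\<eta>) \<le>
           (op_norm A * (set_sup_norm (supp \<rho>))\<^sup>2) * norm (z\<rho> - z\<eta>)
           + kappa' A (mat 1 :: real ^ 'm ^ 'm) \<rho> \<eta> z\<eta> * ?dZ
           + zeta' A (mat 1 :: real ^ 'm ^ 'm) \<rho> \<eta> z\<eta> * ?dN"
      using dual_part norm_triangle_ineq[of "tilted_mean \<rho> ?y\<rho> - tilted_mean \<rho> ?y\<eta>"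
          "tilted_mean \<rho> ?y\<eta> - tilted_mean \<eta> ?y\<eta>"]
      by (simp add: x\<rho> x\<eta>)
  next
    fix \<gamma> :: real
    assume inj: "inj (\<lambda>x. A *v x)" and \<gamma>: "\<gamma> > 0" and sc: "strongly_convex (1 / \<gamma>) g"
    have "1 / \<gamma> * norm ((A *v x\<rho> - b) - (A *v x\<eta> - b)) \<le> norm (- z\<rho> /\<^sub>R \<alpha> - - z\<eta> /\<^sub>R \<alpha>)"
      unfolding x\<rho> x\<eta> by (rule strongly_convex_subgradient_monotone[OF sc subgradient_\<rho> subgradient_\<eta>])
    also have "- z\<rho> /\<^sub>R \<alpha> - - z\<eta> /\<^sub>R \<alpha> = (- inverse \<alpha>) *\<^sub>R (z\<rho> - z\<eta>)"
      by (simp add: algebra_simps)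
    also have "norm \<dots> = norm (z\<rho> - z\<eta>) / \<alpha>"
      using \<open>\<alpha> > 0\<close> by (simp add: divide_inverse)
    also have "(A *v x\<rho> - b) - (A *v x\<eta> - b) = A *v (x\<rho> - x\<eta>)"
      by (simp add: matrix_vector_mult_diff_distrib)
    finally have "norm (A *v (x\<rho> - x\<eta>)) \<le> \<gamma> / \<alpha> * norm (z\<rho> - z\<eta>)"
      using \<gamma> \<open>\<alpha> > 0\<close> by (simp add: field_simps)
    with sigma_min_le[of A "x\<rho> - x\<eta>"]
    have "sigma_min A * norm (x\<rho> - x\<eta>) \<le> \<gamma> / \<alpha> * norm (z\<rho> - z\<eta>)" by linarith
    then show "norm (x\<rho> - x\<eta>) \<le> \<gamma> / (\<alpha> * sigma_min A) * norm (z\<rho> - z\<eta>)"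
      using sigma_min_pos[OF inj] \<open>\<alpha> > 0\<close> by (simp add: field_simps)
  }
qed

end
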